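(* Let $\alpha>0$, $c\ge1$ and $\epsilon>0$, and let $\kappa_1=L(\Lambda_1)/\alpha$. Suppose the points $x^t$ are generated by the ACGD method (described in the context) with stepsizes, for $t\ge1$, $$\tau_t=\min\{\tfrac{t-1}{2},\sqrt{\kappa_1}\},\quad \eta_t=\frac{L(\Lambda_1)}{\tau_{t+1}},\quad \theta_t=\frac{\tau_t}{\tau_{t-1}+1},\quad \omega_1=1,\ \ \omega_t=\omega_{t-1}/\theta_t\ (t\ge2).$$ Then the ergodic average $\bar x^N=\sum_{t=1}^N\omega_tx^t/\sum_{t=1}^N\omega_t$ is an $(\epsilon;\epsilon/c)$-optimal solution, i.e. $F(\bar x^N)-F_*\le\epsilon$ and $\|[g(\bar x^N)]_+\|\le\epsilon/c$, whenever $$N\ge\min\left\{\sqrt{\tfrac{2\max\{c,1\}L(\Lambda_1)}{\epsilon}}\,\|x^0-x^*\|,\ \Big[\sqrt{\tfrac{2L(\Lambda_1)}{\alpha}}+1\Big]\log\Big[\tfrac{\max\{c,1\}\sqrt{L(\Lambda_1)\alpha}\,\|x^0-x^*\|^2}{\epsilon}+1\Big]+4\right\}.$$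
   Context: Problem: $\min_{x\in X}\{F(x):=f(x)+u(x)\}$ subject to $g(x)\le 0$, where $X\subseteq\mathbb R^n$ is closed and convex, $f:\mathbb R^n\to\mathbb R$ and $g=(g_1,\dots,g_m):\mathbb R^n\to\mathbb R^m$ are convex (componentwise) and differentiable with Lipschitz continuous gradients, and $u$ is a convex, $\alpha$-strongly convex function. Norms are Euclidean, $[\cdot]_+$ is the componentwise positive part, $\nabla g(x)$ is the $m\times n$ Jacobian. The set of optimal solutions is nonempty, and there is a KKT pair: $x^*\in X$ optimal, $\lambda^*\in\mathbb R^m_+$ with $-[\nabla f(x^* )+\sum_i\lambda_i^*\nabla g_i(x^* )+u']\in N_X(x^* )$ for some $u'\in\partial u(x^* )$, $g(x^* )\le0$, $\lambda^*_ig_i(x^* )=0$ for all $i$; $F_*=F(x^* )$. Aggregate smoothness: for $\lambda\in\mathbb R^m_+$, $L_\lambda$ is a Lipschitz constant on $\mathbb R^n$ of the gradient of $f+\sum_i\lambda_ig_i$; for $\Lambda\subseteq\mathbb R^m_+$, $L(\Lambda)=\sup_{\lambda\in\Lambda}L_\lambda$. $\Lambda_r=\{0\}\cup\{\lambda^*+\lambda:\lambda\in\mathbb R^m_+,\|\lambda\|\le r\}$. Convention: the Lipschitz constant $L_f$ of $\nabla f$ is chosen with $L_f\ge\alpha$ (constants need not be minimal), so $L(\Lambda_1)\ge\alpha$. ACGD method: given $x^{-1}=\underline x^0=x^0\in X$, stepsizes $\theta_t,\eta_t,\tau_t$ and weights $\omega_t$. For $t=1,\dots,N$ ($N\ge1$):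 set $\tilde x^t=x^{t-1}+\theta_t(x^{t-1}-x^{t-2})$, $\underline x^t=(\tau_t\underline x^{t-1}+\tilde x^t)/(1+\tau_t)$, $\pi^t=\nabla f(\underline x^t)$, $\nu^t=\nabla g(\underline x^t)$, and $$x^t\in\operatorname{argmin}_{x\in X}\{\langle\pi^t,x\rangle+u(x)+\tfrac{\eta_t}{2}\|x-x^{t-1}\|^2:\ \nu^t(x-\underline x^t)+g(\underline x^t)\le0\}.$$ The method identifies this step with the $x$-component of a saddle point $(x^t,\lambda^t)$ of $\min_{x\in X}\max_{\lambda\in\mathbb R^m_+}\langle\pi^t,x\rangle+\langle\lambda,\nu^t(x-\underline x^t)+g(\underline x^t)\rangle+u(x)+\frac{\eta_t}{2}\|x-x^{t-1}\|^2$, i.e. a multiplier $\lambda^t$ is taken to exist. *)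

theory Defs
  imports "HOL-Analysis.Analysis"
begin

definition gradient :: "('a::real_inner \<Rightarrow> real) \<Rightarrow> 'a \<Rightarrow> 'a" where
  "gradient h x = (THE D. GDERIV h x :> D)"

lemma gradient_eqI:
  assumes "GDERIV h x :> D"
  shows "gradient h x = D"
  unfolding gradient_def
proof (rule the_equality)
  show "GDERIV h x :> D" by (fact assms)
next
  fix E assume "GDERIV h x :> E"
  with assms have "(\<lambda>v. inner v E) = (\<lambda>v. inner v D)"
    unfolding gderiv_def by (metis has_derivative_unique)
  then have "inner (E - D) (E - D) = 0"
    by (metis inner_diff_right right_minus_eq)
  then show "E = D" by simp
qed

text \<open>The constant need not be minimal.\<close>

definition lipschitz_gradient :: "real \<Rightarrow> ('a::real_inner \<Rightarrow> real) \<Rightarrow> bool" where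
  "lipschitz_gradient C h \<longleftrightarrow>
     (\<forall>x. h differentiable (at x)) \<and> C-lipschitz_on UNIV (gradient h)"

definition strongly_convex_on ::
    "'a::real_inner set \<Rightarrow> real \<Rightarrow> ('a \<Rightarrow> real) \<Rightarrow> bool" where
  "strongly_convex_on S \<alpha> u \<longleftrightarrow> convex S \<and>
     (\<forall>x\<in>S. \<forall>y\<in>S. \<forall>s\<in>{0..1}.
        u (s *\<^sub>R x + (1 - s) *\<^sub>R y)
          \<le> s * u x + (1 - s) * u y - \<alpha> / 2 * s * (1 - s) * (norm (x - y))\<^sup>2)"

text \<open>Only the values of \<open>u\<close> on \<open>S\<close> matter: this is the subdifferential of the function
  that equals \<open>u\<close> on \<open>S\<close> and \<open>\<infinity>\<close> elsewhere. For \<open>S = UNIV\<close> it is the usual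
  one, and enlarging \<open>S\<close> makes it smaller.\<close>

definition subdifferential_on ::
    "'a::real_inner set \<Rightarrow> ('a \<Rightarrow> real) \<Rightarrow> 'a \<Rightarrow> 'a set" where
  "subdifferential_on S u x = {v. \<forall>y\<in>S. u y \<ge> u x + inner v (y - x)}"

definition normal_cone :: "'a::real_inner set \<Rightarrow> 'a \<Rightarrow> 'a set" where
  "normal_cone S x = {v. \<forall>y\<in>S. inner v (y - x) \<le> 0}"

definition pos_part :: "real^'m \<Rightarrow> real^'m" where
  "pos_part v = (\<chi> i. max (v $ i) 0)"

definition optimal_solution ::
    "(real^'n) set \<Rightarrow> (real^'n \<Rightarrow> real) \<Rightarrow> (real^'n \<Rightarrow> real^'m) \<Rightarrow> real^'n \<Rightarrow> bool" where
  "optimal_solution X F g x \<longleftrightarrow> is_arg_min F (\<lambda>y. y \<in> X \<and> g y \<le> 0) x"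

definition KKT_pair ::
    "(real^'n) set \<Rightarrow> (real^'n \<Rightarrow> real) \<Rightarrow> (real^'n \<Rightarrow> real^'m) \<Rightarrow> (real^'n \<Rightarrow> real)
      \<Rightarrow> real^'n \<Rightarrow> real^'m \<Rightarrow> bool" where
  "KKT_pair X f g u x l \<longleftrightarrow> x \<in> X \<and> 0 \<le> l \<and>
     (\<exists>u'\<in>subdifferential_on X u x.
        - (gradient f x + (\<Sum>i\<in>UNIV. (l $ i) *\<^sub>R gradient (\<lambda>y. g y $ i) x) + u')
          \<in> normal_cone X x) \<and>
     g x \<le> 0 \<and> (\<forall>i. l $ i * g x $ i = 0)"

definition multiplier_region :: "real^'m \<Rightarrow> real \<Rightarrow> (real^'m) set" where
  "multiplier_region lstar r = {0} \<union> {lstar + l | l. 0 \<le> l \<and> norm l \<le> r}"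

definition aggregate_smoothness :: "(real^'m \<Rightarrow> real) \<Rightarrow> (real^'m) set \<Rightarrow> real" where
  "aggregate_smoothness Lip \<Lambda> = (SUP l\<in>\<Lambda>. Lip l)"

definition saddle_point ::
    "'a set \<Rightarrow> 'b set \<Rightarrow> ('a \<Rightarrow> 'b \<Rightarrow> real) \<Rightarrow> 'a \<Rightarrow> 'b \<Rightarrow> bool" where
  "saddle_point A B \<Phi> a b \<longleftrightarrow> a \<in> A \<and> b \<in> B \<and>
     (\<forall>b'\<in>B. \<Phi> a b' \<le> \<Phi> a b) \<and> (\<forall>a'\<in>A. \<Phi> a b \<le> \<Phi> a' b)"

definition linearization :: "(real^'n \<Rightarrow> real^'m) \<Rightarrow> real^'n \<Rightarrow> real^'n \<Rightarrow> real^'m" where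
  "linearization g y x = jacobian g (at y) *v (x - y) + g y"

text \<open>One proximal step: \<open>y\<close> is the linearization point, \<open>p\<close> the previous iterate and
  \<open>x\<close> the new one. Existence of a multiplier is part of the method; it is not automatic, since
  no constraint qualification is imposed on the linearized constraints.\<close>

definition acgd_step ::
    "(real^'n) set \<Rightarrow> (real^'n \<Rightarrow> real) \<Rightarrow> (real^'n \<Rightarrow> real^'m) \<Rightarrow> (real^'n \<Rightarrow> real)
      \<Rightarrow> real \<Rightarrow> real^'n \<Rightarrow> real^'n \<Rightarrow> real^'n \<Rightarrow> bool" where
  "acgd_step X f g u \<eta> y p x \<longleftrightarrow>
     is_arg_min (\<lambda>z. inner (gradient f y) z + u z + \<eta> / 2 * (norm (z - p))\<^sup>2)
       (\<lambda>z. z \<in> X \<and> linearization g y z \<le> 0) x \<and>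
     (\<exists>l. saddle_point X {l. 0 \<le> l}
        (\<lambda>z l. inner (gradient f y) z + inner l (linearization g y z)
               + u z + \<eta> / 2 * (norm (z - p))\<^sup>2) x l)"

text \<open>\<open>x t\<close> and \<open>xu t\<close> are the iterates and the linearization points. The \<open>if\<close>
  implements the convention that the iterate with index \<open>-1\<close> is \<open>x 0\<close>.\<close>

definition acgd_iterates ::
    "(real^'n) set \<Rightarrow> (real^'n \<Rightarrow> real) \<Rightarrow> (real^'n \<Rightarrow> real^'m) \<Rightarrow> (real^'n \<Rightarrow> real)
      \<Rightarrow> (nat \<Rightarrow> real) \<Rightarrow> (nat \<Rightarrow> real) \<Rightarrow> (nat \<Rightarrow> real) \<Rightarrow> nat
      \<Rightarrow> (nat \<Rightarrow> real^'n) \<Rightarrow> (nat \<Rightarrow> real^'n) \<Rightarrow> bool" where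
  "acgd_iterates X f g u \<theta> \<eta> \<tau> N x xu \<longleftrightarrow>
     x 0 \<in> X \<and> xu 0 = x 0 \<and>
     (\<forall>t\<in>{1..N}.
        (let xt = x (t - 1) + \<theta> t *\<^sub>R (x (t - 1) - (if t = 1 then x 0 else x (t - 2)))
         in xu t = (1 / (1 + \<tau> t)) *\<^sub>R (\<tau> t *\<^sub>R xu (t - 1) + xt)) \<and>
        acgd_step X f g u (\<eta> t) (xu t) (x (t - 1)) (x t))"

end

theory Submission
  imports Defs
begin

text \<open>
  For \<open>l \<ge> 0\<close> let \<open>h = f + \<langle>l, g\<rangle>\<close> be the Lagrangian without \<open>u\<close>. The method behaves
  like Nesterov's accelerated proximal gradient method applied to \<open>h + u\<close> for every such
  \<open>l\<close> at the same time, although it never chooses an \<open>l\<close>. There are two reasons.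

  First, the linearization points do not depend on \<open>l\<close>, and they are the right ones. With
  \<open>W t\<close> the sum of the first \<open>t\<close> weights and \<open>avg x t\<close> the weighted average of the first
  \<open>t\<close> iterates, the recurrences for \<open>\<tau>\<close>, \<open>\<theta>\<close> and \<open>\<omega>\<close> give
  \<open>W t *\<^sub>R xu t = W (t - 1) *\<^sub>R avg x (t - 1) + \<omega> t *\<^sub>R x (t - 1)\<close>
  (\<open>linearization_point_eq\<close>).

  Second, the multiplier of a proximal step is the best response to the new iterate. Replacing it
  by an arbitrary \<open>l \<ge> 0\<close> only weakens the optimality inequality of the step, which then
  bounds the linear model of \<open>h\<close> at the new iterate (\<open>acgd_step_model_inequality\<close>).

  The usual potential argument (\<open>accelerated_potential_decrease\<close>) now shows, for every
  \<open>l \<ge> 0\<close> for which the gradient of \<open>h\<close> has Lipschitz constant at most \<open>L\<close>, that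
  \<open>W N * (F xbar + \<langle>l, g xbar\<rangle> - F xstar) \<le> L * (norm (x 0 - xstar))\<^sup>2\<close>
  (\<open>lagrangian_gap_bound\<close>). Taking \<open>l = 0\<close> bounds the objective. Taking
  \<open>l = lstar + v\<close>, with \<open>v\<close> the normalized positive part of \<open>g xbar\<close>, bounds the
  violation, because \<open>F xbar + \<langle>lstar, g xbar\<rangle> \<ge> F xstar\<close> by the KKT conditions
  (\<open>KKT_pair_lagrangian_minimal\<close>).

  It remains to see that \<open>W N\<close> is large enough. It grows at least like \<open>N\<^sup>2 / 2\<close>, and by a
  factor of at least \<open>1 + 1 / s\<close> per step, where \<open>s\<close> is the square root of the condition
  number. The two alternatives in the condition on \<open>N\<close> correspond to these two rates (\<open>iteration_count\<close>).
\<close>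

section \<open>Gradients along lines\<close>

lemma GDERIV_gradient:
  fixes h :: "'a::euclidean_space \<Rightarrow> real"
  assumes "h differentiable (at x)"
  shows "GDERIV h x :> gradient h x"
proof -
  obtain h' where h': "(h has_derivative h') (at x)"
    using assms by (auto simp: differentiable_def)
  define D where "D = adjoint h' 1"
  have "linear h'" using h' by (rule has_derivative_linear)
  then have "h' v = inner v D" for v
    using adjoint_works[of h' v 1] by (simp add: D_def)
  then have "h' = (\<lambda>v. inner v D)" by auto
  with h' have "GDERIV h x :> D" by (simp add: gderiv_def)
  then show ?thesis using gradient_eqI by metis
qed

lemma DERIV_along_line:
  fixes h :: "'a::euclidean_space \<Rightarrow> real"
  assumes "h differentiable (at (x + t *\<^sub>R d))"
  shows "((\<lambda>t. h (x + t *\<^sub>R d)) has_real_derivative inner (gradient h (x + t *\<^sub>R d)) d) (at t)"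
proof -
  have "((\<lambda>t. x + t *\<^sub>R d) has_derivative (\<lambda>s. s *\<^sub>R d)) (at t)"
    by (auto intro!: derivative_eq_intros)
  moreover have "(h has_derivative (\<lambda>v. inner v (gradient h (x + t *\<^sub>R d)))) (at (x + t *\<^sub>R d))"
    using GDERIV_gradient[OF assms] by (simp add: gderiv_def)
  ultimately have "((\<lambda>t. h (x + t *\<^sub>R d)) has_derivative
      (\<lambda>s. inner (s *\<^sub>R d) (gradient h (x + t *\<^sub>R d)))) (at t)"
    by (rule has_derivative_compose)
  moreover have "(\<lambda>s. inner (s *\<^sub>R d) (gradient h (x + t *\<^sub>R d)))
      = (*) (inner (gradient h (x + t *\<^sub>R d)) d)"
    by (auto simp: inner_commute mult.commute)
  ultimately show ?thesis by (simp add: has_field_derivative_def)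
qed

text \<open>Both first-order bounds of this section come from restricting the function to the line from
  \<open>x\<close> to \<open>y\<close>, where one-dimensional calculus applies.\<close>

lemma convex_above_tangent_plane:
  fixes h :: "'a::euclidean_space \<Rightarrow> real"
  assumes "convex_on UNIV h" and "h differentiable (at x)"
  shows "h x + inner (gradient h x) (y - x) \<le> h y"
proof -
  let ?p = "\<lambda>t::real. h (x + t *\<^sub>R (y - x))"
  have "convex_on UNIV ?p"
  proof (rule convex_onI)
    fix t a b :: real assume t: "0 < t" "t < 1"
    have "x + ((1 - t) *\<^sub>R a + t *\<^sub>R b) *\<^sub>R (y - x)
        = (1 - t) *\<^sub>R (x + a *\<^sub>R (y - x)) + t *\<^sub>R (x + b *\<^sub>R (y - x))"
      by (simp add: algebra_simps)
    then show "?p ((1 - t) *\<^sub>R a + t *\<^sub>R b) \<le> (1 - t) * ?p a + t * ?p b"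
      using convex_onD[OF assms(1), of t] t by simp
  qed simp
  moreover have "(?p has_real_derivative inner (gradient h x) (y - x)) (at 0)"
    using DERIV_along_line[of h x 0 "y - x"] assms(2) by simp
  ultimately have "?p 1 - ?p 0 \<ge> inner (gradient h x) (y - x) * (1 - 0)"
    by (intro convex_on_imp_above_tangent[where A = UNIV]) auto
  then show ?thesis by simp
qed

lemma descent_lemma:
  fixes h :: "'a::euclidean_space \<Rightarrow> real"
  assumes "lipschitz_gradient C h"
  shows "h y \<le> h x + inner (gradient h x) (y - x) + C / 2 * (norm (y - x))\<^sup>2"
proof -
  define d where "d = y - x"
  have diff: "h differentiable (at z)" for z
    using assms by (simp add: lipschitz_gradient_def)
  \<comment> \<open>The function minus the increment of its quadratic model: the Lipschitz bound on the
    gradient, with Cauchy--Schwarz, makes its derivative nonpositive on \<open>[0, 1]\<close>.\<close>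
  let ?p = "\<lambda>t. h (x + t *\<^sub>R d) - t * inner (gradient h x) d - C / 2 * (norm d)\<^sup>2 * t\<^sup>2"
  have "?p 1 \<le> ?p 0"
  proof (rule DERIV_nonpos_imp_nonincreasing[where f = ?p and a = 0 and b = 1])
    fix t :: real assume t: "0 \<le> t" "t \<le> 1"
    have "(?p has_real_derivative
        inner (gradient h (x + t *\<^sub>R d)) d - inner (gradient h x) d - C * (norm d)\<^sup>2 * t) (at t)"
      by (auto intro!: derivative_eq_intros DERIV_along_line diff)
    moreover have "inner (gradient h (x + t *\<^sub>R d)) d - inner (gradient h x) d \<le> C * (norm d)\<^sup>2 * t"
    proof -
      have "inner (gradient h (x + t *\<^sub>R d) - gradient h x) d
          \<le> norm (gradient h (x + t *\<^sub>R d) - gradient h x) * norm d"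
        by (rule norm_cauchy_schwarz)
      also have "norm (gradient h (x + t *\<^sub>R d) - gradient h x) \<le> C * norm (t *\<^sub>R d)"
        using assms lipschitz_onD[of C UNIV "gradient h" "x + t *\<^sub>R d" x]
        by (simp add: lipschitz_gradient_def dist_norm)
      finally show ?thesis
        using t by (simp add: inner_diff_left power2_eq_square mult_ac mult_right_mono)
    qed
    ultimately show "\<exists>l. (?p has_real_derivative l) (at t) \<and> l \<le> 0"
      by (intro exI conjI) (assumption, simp)
  qed simp
  then show ?thesis by (simp add: d_def)
qed

section \<open>Strong convexity\<close>

text \<open>Minimality is compared with the point at fraction \<open>s\<close> of the way to \<open>z\<close>. After
  division by \<open>s\<close>, strong convexity leaves the growth term with the factor \<open>1 - s\<close>,
  and \<open>s \<rightarrow> 0\<close> removes that factor.\<close>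

lemma strongly_convex_on_minimizer_growth:
  assumes sc: "strongly_convex_on S \<mu> h" and x: "x \<in> S" and z: "z \<in> S"
    and min: "\<And>y. y \<in> S \<Longrightarrow> h x \<le> h y"
  shows "h x + \<mu> / 2 * (norm (z - x))\<^sup>2 \<le> h z"
proof -
  let ?q = "\<mu> / 2 * (norm (z - x))\<^sup>2"
  have bound: "h x + (1 - s) * ?q \<le> h z" if s: "0 < s" "s \<le> 1" for s
  proof -
    have "convex S" using sc by (simp add: strongly_convex_on_def)
    then have "s *\<^sub>R z + (1 - s) *\<^sub>R x \<in> S"
      using x z s by (intro convexD) auto
    then have "h x \<le> h (s *\<^sub>R z + (1 - s) *\<^sub>R x)" by (rule min)
    also have "\<dots> \<le> s * h z + (1 - s) * h x - \<mu> / 2 * s * (1 - s) * (norm (z - x))\<^sup>2"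
      using sc x z s by (auto simp: strongly_convex_on_def)
    finally have "s * (h x + (1 - s) * ?q) \<le> s * h z" by (simp add: algebra_simps)
    with s show ?thesis by simp
  qed
  have lim: "((\<lambda>s. h x + (1 - s) * ?q) \<longlongrightarrow> h x + (1 - 0) * ?q) (at_right 0)"
    by (intro tendsto_intros)
  have "\<forall>\<^sub>F s in at_right 0. h x + (1 - s) * ?q \<le> h z"
    unfolding eventually_at_right_field by (intro exI[of _ 1] conjI allI impI bound) auto
  from tendsto_upperbound[OF lim this] show ?thesis by simp
qed

lemma norm_convex_combination:
  fixes x y :: "'a::real_inner"
  shows "(norm (s *\<^sub>R x + (1 - s) *\<^sub>R y))\<^sup>2
    = s * (norm x)\<^sup>2 + (1 - s) * (norm y)\<^sup>2 - s * (1 - s) * (norm (x - y))\<^sup>2"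
  unfolding power2_norm_eq_inner
  by (simp add: inner_commute[of y x] algebra_simps)

text \<open>The shape of the objective of a proximal step once the constraints have been moved into it with
  a fixed multiplier: an affine function, \<open>u\<close>, and a squared distance, which contributes its
  own modulus \<open>\<eta>\<close>. Its minimizer therefore satisfies a quadratic growth bound with modulus
  \<open>\<eta> + \<alpha>\<close>.\<close>

lemma strongly_convex_on_add_prox:
  assumes "strongly_convex_on S \<mu> u"
  shows "strongly_convex_on S (\<eta> + \<mu>) (\<lambda>z. inner v z + b + u z + \<eta> / 2 * (norm (z - p))\<^sup>2)"
  unfolding strongly_convex_on_def
proof (intro conjI ballI)
  show "convex S" using assms by (simp add: strongly_convex_on_def)
  fix x y and s :: real assume xy: "x \<in> S" "y \<in> S" and s: "s \<in> {0..1}"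
  let ?w = "s *\<^sub>R x + (1 - s) *\<^sub>R y"
  have u: "u ?w \<le> s * u x + (1 - s) * u y - \<mu> / 2 * s * (1 - s) * (norm (x - y))\<^sup>2"
    using assms xy s by (simp add: strongly_convex_on_def)
  have "?w - p = s *\<^sub>R (x - p) + (1 - s) *\<^sub>R (y - p)" by (simp add: algebra_simps)
  then have q: "(norm (?w - p))\<^sup>2
      = s * (norm (x - p))\<^sup>2 + (1 - s) * (norm (y - p))\<^sup>2 - s * (1 - s) * (norm (x - y))\<^sup>2"
    using norm_convex_combination[of s "x - p" "y - p"] by simp
  show "inner v ?w + b + u ?w + \<eta> / 2 * (norm (?w - p))\<^sup>2
    \<le> s * (inner v x + b + u x + \<eta> / 2 * (norm (x - p))\<^sup>2)
      + (1 - s) * (inner v y + b + u y + \<eta> / 2 * (norm (y - p))\<^sup>2)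
      - (\<eta> + \<mu>) / 2 * s * (1 - s) * (norm (x - y))\<^sup>2"
    unfolding q using u by (simp add: inner_add_right algebra_simps add_divide_distrib diff_divide_distrib)
qed

section \<open>The Lagrangian and the linearized constraints\<close>

text \<open>The rows of the Jacobian are the gradients of the components; this links the linearized
  constraints of the method to the gradient of the Lagrangian.\<close>

lemma jacobian_component:
  fixes g :: "real^'n \<Rightarrow> real^'m"
  assumes "\<And>i. (\<lambda>y. g y $ i) differentiable (at y)"
  shows "(jacobian g (at y) *v v) $ i = inner (gradient (\<lambda>y. g y $ i) y) v"
proof -
  have "g differentiable (at y)"
  proof (subst differentiable_componentwise_within, intro ballI)
    fix b :: "real^'m" assume "b \<in> Basis"
    then obtain j where "b = axis j 1" by (auto simp: Basis_vec_def)
    then show "(\<lambda>x. inner (g x) b) differentiable (at y)"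
      using assms[of j] by (simp add: inner_axis)
  qed
  then have "(g has_derivative (\<lambda>v. jacobian g (at y) *v v)) (at y)"
    using jacobian_works by blast
  then have 1: "((\<lambda>y. g y $ i) has_derivative (\<lambda>v. (jacobian g (at y) *v v) $ i)) (at y)"
    by (rule bounded_linear.has_derivative[OF bounded_linear_vec_nth])
  have 2: "((\<lambda>y. g y $ i) has_derivative (\<lambda>v. inner v (gradient (\<lambda>y. g y $ i) y))) (at y)"
    using GDERIV_gradient[OF assms] by (simp add: gderiv_def)
  show ?thesis using has_derivative_unique[OF 1 2] by (metis inner_commute)
qed

definition lagrangian :: "(real^'n \<Rightarrow> real) \<Rightarrow> (real^'n \<Rightarrow> real^'m) \<Rightarrow> real^'m \<Rightarrow> real^'n \<Rightarrow> real"
  where "lagrangian f g l y = f y + (\<Sum>i\<in>UNIV. l $ i * g y $ i)"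

lemma lagrangian_eq_inner: "lagrangian f g l y = f y + inner l (g y)"
  by (simp add: lagrangian_def inner_vec_def)

lemma gradient_lagrangian:
  fixes f :: "real^'n \<Rightarrow> real" and g :: "real^'n \<Rightarrow> real^'m"
  assumes f: "f differentiable (at y)" and g: "\<And>i. (\<lambda>y. g y $ i) differentiable (at y)"
  shows "gradient (lagrangian f g l) y
      = gradient f y + (\<Sum>i\<in>UNIV. (l $ i) *\<^sub>R gradient (\<lambda>y. g y $ i) y)"
proof (rule gradient_eqI, unfold gderiv_def)
  have F: "(f has_derivative (\<lambda>v. inner v (gradient f y))) (at y)"
    using GDERIV_gradient[OF f] by (simp add: gderiv_def)
  have G: "((\<lambda>y. g y $ i) has_derivative (\<lambda>v. inner v (gradient (\<lambda>y. g y $ i) y))) (at y)" for i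
    using GDERIV_gradient[OF g] by (simp add: gderiv_def)
  show "(lagrangian f g l has_derivative (\<lambda>v. inner v (gradient f y
      + (\<Sum>i\<in>UNIV. (l $ i) *\<^sub>R gradient (\<lambda>y. g y $ i) y)))) (at y)"
    unfolding lagrangian_def[abs_def]
    by (rule has_derivative_eq_rhs,
        rule has_derivative_add[OF F has_derivative_sum[OF has_derivative_mult_right[OF G]]])
      (simp add: inner_add_right inner_sum_right)
qed

lemma convex_on_lagrangian:
  fixes f :: "real^'n \<Rightarrow> real" and g :: "real^'n \<Rightarrow> real^'m"
  assumes "convex_on UNIV f" and "\<And>i. convex_on UNIV (\<lambda>y. g y $ i)" and "0 \<le> l"
  shows "convex_on UNIV (lagrangian f g l)"
proof -
  have "convex_on UNIV (\<lambda>y. \<Sum>i\<in>A. l $ i * g y $ i)" if "finite A" for A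
    using that
  proof induction
    case (insert i A)
    have "0 \<le> l $ i" using assms(3) by (simp add: less_eq_vec_def)
    with insert show ?case by (simp add: convex_on_add convex_on_cmul assms(2))
  qed (simp add: convex_on_const)
  then show ?thesis
    unfolding lagrangian_def[abs_def] by (simp add: convex_on_add assms(1))
qed

lemma inner_linearization:
  fixes g :: "real^'n \<Rightarrow> real^'m"
  assumes "\<And>i. (\<lambda>y. g y $ i) differentiable (at y)"
  shows "inner l (linearization g y z) = inner (\<Sum>i\<in>UNIV. (l $ i) *\<^sub>R gradient (\<lambda>y. g y $ i) y) (z - y)
     + inner l (g y)"
  by (simp add: linearization_def inner_add_right inner_sum_left)
     (simp add: inner_vec_def jacobian_component[OF assms] del: inner_real_def, simp)

lemma linearization_le:
  fixes g :: "real^'n \<Rightarrow> real^'m"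
  assumes "\<And>i. convex_on UNIV (\<lambda>y. g y $ i)" and "\<And>i. (\<lambda>y. g y $ i) differentiable (at y)"
  shows "linearization g y z \<le> g z"
  using convex_above_tangent_plane[OF assms]
  by (simp add: less_eq_vec_def linearization_def jacobian_component[OF assms(2)] add.commute)

text \<open>The Karush--Kuhn--Tucker conditions are the first-order optimality conditions for minimizing the
  convex function \<open>lagrangian f g ls + u\<close> over \<open>X\<close>; complementary slackness makes the
  minimal value equal to the objective at \<open>xs\<close>. At an infeasible \<open>z\<close> this limits
  how far the objective can drop below its optimal value.\<close>

lemma KKT_pair_lagrangian_minimal:
  fixes g :: "real^'n \<Rightarrow> real^'m"
  assumes kkt: "KKT_pair X f g u xs ls"
    and f: "convex_on UNIV f" "\<And>y. f differentiable (at y)"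
    and g: "\<And>i. convex_on UNIV (\<lambda>y. g y $ i)" "\<And>i y. (\<lambda>y. g y $ i) differentiable (at y)"
    and z: "z \<in> X" and lag: "\<And>y. lagrangian f g ls differentiable (at y)"
  shows "f xs + u xs \<le> f z + u z + inner ls (g z)"
proof -
  let ?D = "gradient (lagrangian f g ls) xs"
  have D: "?D = gradient f xs + (\<Sum>i\<in>UNIV. (ls $ i) *\<^sub>R gradient (\<lambda>y. g y $ i) xs)"
    by (rule gradient_lagrangian[OF f(2) g(2)])
  have ls: "0 \<le> ls" and "\<forall>i. ls $ i * g xs $ i = 0" using kkt by (auto simp: KKT_pair_def)
  then have slack: "inner ls (g xs) = 0" by (auto simp: inner_vec_def intro!: sum.neutral)
  obtain v where v: "v \<in> subdifferential_on X u xs" "- (?D + v) \<in> normal_cone X xs"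
    using kkt unfolding KKT_pair_def D by blast
  have "u z \<ge> u xs + inner v (z - xs)" using v z by (simp add: subdifferential_on_def)
  moreover have "inner (- (?D + v)) (z - xs) \<le> 0"
    using v(2) z unfolding normal_cone_def by blast
  then have "inner ?D (z - xs) + inner v (z - xs) \<ge> 0"
    by (simp only: inner_minus_left inner_add_left)
  moreover have "lagrangian f g ls xs + inner ?D (z - xs) \<le> lagrangian f g ls z"
    by (rule convex_above_tangent_plane[OF convex_on_lagrangian[OF f(1) g(1) ls] lag])
  ultimately show ?thesis using slack by (simp add: lagrangian_eq_inner)
qed

text \<open>The witness is the normalized positive part, so that the norm of the constraint violation
  appears as a linear functional of the constraint values. If there is no violation then it is
  \<open>0\<close> because \<open>1 / 0 = 0\<close>.\<close>

lemma norm_pos_part_certificate: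
  fixes v :: "real^'m"
  obtains l where "0 \<le> l" "norm l \<le> 1" "inner l v = norm (pos_part v)"
proof
  define l where "l = (1 / norm (pos_part v)) *\<^sub>R pos_part v"
  show "0 \<le> l" by (simp add: l_def pos_part_def less_eq_vec_def)
  show "norm l \<le> 1" by (simp add: l_def)
  have "inner (pos_part v) v = inner (pos_part v) (pos_part v)"
    unfolding inner_vec_def by (rule sum.cong) (auto simp: pos_part_def max_def)
  then show "inner l v = norm (pos_part v)"
    by (simp add: l_def power2_norm_eq_inner[symmetric] power2_eq_square)
qed

section \<open>One accelerated step\<close>

text \<open>The left-hand side involves an arbitrary multiplier \<open>l\<close>, although the step was computed with
  its own multiplier \<open>m\<close>. The exchange is possible because \<open>m\<close> is the best response to
  \<open>x\<close> in the saddle point problem, so replacing \<open>m\<close> by \<open>l\<close> can only decrease the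
  constraint term at \<open>x\<close>. At the comparison point \<open>z\<close> the term with \<open>m\<close> can be
  dropped: the linearized constraints lie below \<open>g\<close>, and \<open>z\<close> is feasible. The rest is
  quadratic growth around the minimizer \<open>x\<close> of the step.\<close>

lemma acgd_step_model_inequality:
  fixes g :: "real^'n \<Rightarrow> real^'m"
  assumes step: "acgd_step X f g u \<eta> y p x"
    and sc: "strongly_convex_on X \<alpha> u"
    and f: "convex_on UNIV f" "f differentiable (at y)"
    and g: "\<And>i. convex_on UNIV (\<lambda>y. g y $ i)" "\<And>i. (\<lambda>y. g y $ i) differentiable (at y)"
    and z: "z \<in> X" "g z \<le> 0" and l: "0 \<le> l"
  shows "lagrangian f g l y + inner (gradient (lagrangian f g l) y) (x - y) + u x
      + \<eta> / 2 * (norm (x - p))\<^sup>2 + (\<eta> + \<alpha>) / 2 * (norm (z - x))\<^sup>2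
    \<le> f z + u z + \<eta> / 2 * (norm (z - p))\<^sup>2"
proof -
  define lin where "lin = linearization g y"
  obtain m where sp: "saddle_point X {l. 0 \<le> l}
        (\<lambda>z l. inner (gradient f y) z + inner l (lin z)
               + u z + \<eta> / 2 * (norm (z - p))\<^sup>2) x m"
    using step unfolding acgd_step_def lin_def by blast
  then have x: "x \<in> X" and m: "0 \<le> m" by (auto simp: saddle_point_def)
  have switch: "inner l (lin x) \<le> inner m (lin x)"
    using sp l by (auto simp: saddle_point_def)
  define v where "v = (\<Sum>i\<in>UNIV. (m $ i) *\<^sub>R gradient (\<lambda>y. g y $ i) y)"
  define b where "b = inner m (g y) - inner v y"
  have m_lin: "inner m (lin w) = inner v w + b" for w
    using inner_linearization[OF g(2), where l = m and z = w]
    by (simp add: lin_def v_def b_def inner_diff_right)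
  define \<Phi> where "\<Phi> w = inner (gradient f y + v) w + b + u w + \<eta> / 2 * (norm (w - p))\<^sup>2" for w
  have \<Phi>_eq: "\<Phi> w = inner (gradient f y) w + inner m (lin w) + u w + \<eta> / 2 * (norm (w - p))\<^sup>2" for w
    by (simp add: \<Phi>_def m_lin inner_add_left)
  have "\<Phi> x + (\<eta> + \<alpha>) / 2 * (norm (z - x))\<^sup>2 \<le> \<Phi> z"
  proof (rule strongly_convex_on_minimizer_growth[OF _ x z(1)])
    show "strongly_convex_on X (\<eta> + \<alpha>) \<Phi>"
      unfolding \<Phi>_def[abs_def] by (rule strongly_convex_on_add_prox[OF sc])
    show "\<Phi> x \<le> \<Phi> w" if "w \<in> X" for w
      using sp that unfolding \<Phi>_eq saddle_point_def by blast
  qed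
  moreover have "inner m (lin z) \<le> 0"
  proof -
    have "lin z \<le> 0"
      using linearization_le[OF g, of z] z(2) by (simp add: lin_def)
    then show ?thesis
      using m by (simp add: inner_vec_def less_eq_vec_def sum_nonpos mult_nonneg_nonpos)
  qed
  moreover have "f y + inner (gradient f y) (z - y) \<le> f z"
    using f by (rule convex_above_tangent_plane)
  moreover have "lagrangian f g l y + inner (gradient (lagrangian f g l) y) (x - y)
      = f y + inner (gradient f y) (x - y) + inner l (lin x)"
    using inner_linearization[OF g(2), where l = l and z = x]
    by (simp add: lagrangian_eq_inner gradient_lagrangian[OF f(2) g(2)] lin_def inner_add_left)
  ultimately show ?thesis
    using switch by (simp add: \<Phi>_eq inner_diff_right)
qed

text \<open>The estimate behind Nesterov's accelerated method. Here \<open>q\<close> and \<open>q'\<close> are consecutive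
  averages, \<open>p\<close> and \<open>x\<close> consecutive iterates, and \<open>y\<close> the linearization point. The
  combinations defining \<open>y\<close> and \<open>q'\<close> differ only in \<open>p\<close> and \<open>x\<close>, so \<open>q' - y\<close> is
  the fraction \<open>b / (a + b)\<close> of \<open>x - p\<close>. The error of the quadratic model of \<open>h\<close> at
  \<open>q'\<close> is thus at most what the proximal term \<open>\<eta> / 2 * (norm (x - p))\<^sup>2\<close> pays for. The
  linear part of the model splits over \<open>q\<close>, where convexity bounds it by \<open>h q\<close>, and over
  \<open>x\<close>, where \<open>model\<close> bounds it.\<close>

lemma accelerated_potential_decrease:
  fixes h u :: "'a::euclidean_space \<Rightarrow> real"
  assumes h: "convex_on UNIV h" "lipschitz_gradient C h" and u: "convex_on X u"
    and C: "C \<le> L" and x: "x \<in> X" and q: "q \<in> X"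
    and ab: "0 \<le> a" "0 < b" and Lb: "L * b \<le> \<eta> * (a + b)"
    and y: "(a + b) *\<^sub>R y = a *\<^sub>R q + b *\<^sub>R p"
    and q': "(a + b) *\<^sub>R q' = a *\<^sub>R q + b *\<^sub>R x"
    and model: "h y + inner (gradient h y) (x - y) + u x
      + \<eta> / 2 * (norm (x - p))\<^sup>2 + (\<eta> + \<alpha>) / 2 * (norm (z - x))\<^sup>2
    \<le> V + \<eta> / 2 * (norm (z - p))\<^sup>2"
  shows "(a + b) * (h q' + u q' - V) + b * (\<eta> + \<alpha>) / 2 * (norm (z - x))\<^sup>2
    \<le> a * (h q + u q - V) + b * \<eta> / 2 * (norm (z - p))\<^sup>2"
proof -
  define W where "W = a + b"
  have W: "W > 0" using ab by (simp add: W_def)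
  let ?D = "gradient h y" and ?n = "(norm (x - p))\<^sup>2"
  have Wy: "W *\<^sub>R (q' - y) = b *\<^sub>R (x - p)"
    using y q' by (simp add: W_def scaleR_diff_right)
  have "q' - y = (1 / W) *\<^sub>R (W *\<^sub>R (q' - y))" using W by simp
  also have "\<dots> = (b / W) *\<^sub>R (x - p)" by (simp only: Wy) simp
  finally have n: "W * (norm (q' - y))\<^sup>2 = b * (b / W) * ?n"
    using W by (simp add: power_mult_distrib power2_eq_square)
  have Wq: "W *\<^sub>R (q' - y) = a *\<^sub>R (q - y) + b *\<^sub>R (x - y)"
    using q' by (simp add: W_def algebra_simps)
  have lin: "W * inner ?D (q' - y) = a * inner ?D (q - y) + b * inner ?D (x - y)"
    using arg_cong[OF Wq, of "inner ?D"] by (simp add: inner_add_right)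
  have "h q' \<le> h y + inner ?D (q' - y) + L / 2 * (norm (q' - y))\<^sup>2"
    using descent_lemma[OF h(2), of q' y] C
    by (smt (verit) divide_right_mono mult_right_mono zero_le_power2)
  then have "W * h q' \<le> W * (h y + inner ?D (q' - y) + L / 2 * (norm (q' - y))\<^sup>2)"
    using W by simp
  also have "\<dots> = W * h y + (a * inner ?D (q - y) + b * inner ?D (x - y)) + L / 2 * (b * (b / W) * ?n)"
    unfolding n[symmetric] lin[symmetric] by (simp add: algebra_simps)
  also have "\<dots> = a * (h y + inner ?D (q - y)) + b * (h y + inner ?D (x - y)) + b / 2 * (L * b / W * ?n)"
    by (simp add: W_def algebra_simps)
  also have "\<dots> \<le> a * h q + b * (h y + inner ?D (x - y)) + b / 2 * (\<eta> * ?n)"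
  proof -
    have "h y + inner ?D (q - y) \<le> h q"
      using h by (intro convex_above_tangent_plane) (auto simp: lipschitz_gradient_def)
    moreover have "L * b / W \<le> \<eta>" using Lb W by (simp add: W_def pos_divide_le_eq)
    ultimately show ?thesis
      using ab by (intro add_mono mult_left_mono mult_right_mono) auto
  qed
  finally have hq': "W * h q' \<le> a * h q + b * (h y + inner ?D (x - y)) + b / 2 * (\<eta> * ?n)" .
  have a: "a = W - b" by (simp add: W_def)
  have uq': "W * u q' \<le> a * u q + b * u x"
  proof -
    have "q' = (1 / W) *\<^sub>R (W *\<^sub>R q')" using W by simp
    also have "\<dots> = (1 - b / W) *\<^sub>R q + (b / W) *\<^sub>R x"
      using q' W by (simp add: W_def scaleR_add_right field_simps)
    finally have "u q' \<le> (1 - b / W) * u q + b / W * u x"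
      using convex_onD[OF u, of "b / W" q x] x q ab W by (simp add: W_def)
    then have "W * u q' \<le> W * ((1 - b / W) * u q + b / W * u x)" using W by simp
    also have "\<dots> = a * u q + b * u x" using W by (simp add: a field_simps)
    finally show ?thesis .
  qed
  have "b * (h y + inner ?D (x - y) + u x + \<eta> / 2 * ?n + (\<eta> + \<alpha>) / 2 * (norm (z - x))\<^sup>2)
      \<le> b * (V + \<eta> / 2 * (norm (z - p))\<^sup>2)"
    using model ab by simp
  then show ?thesis
    using hq' uq' by (simp add: W_def algebra_simps add_divide_distrib)
qed

section \<open>Step sizes and weights\<close>

lemma exp_two_le: "exp (2::real) \<le> 9"
proof -
  have "exp (2::real) = exp 1 * exp 1" by (simp flip: exp_add)
  also have "\<dots> \<le> 3 * 3" using exp_le by (intro mult_mono) auto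
  finally show ?thesis by simp
qed

text \<open>The parameter \<open>s\<close> stands for the square root of the condition number, hence
  \<open>L = s\<^sup>2 * \<alpha>\<close>. The recurrences for \<open>\<theta>\<close> and \<open>\<omega>\<close> make the weights satisfy
  \<open>W (t - 1) = \<omega> t * \<tau> t\<close> and \<open>W t = \<omega> t * (1 + \<tau> t)\<close> for their partial sums \<open>W\<close>, so
  that \<open>\<tau> t\<close> is the ratio of the past weight to the new one.\<close>

locale acgd_schedule =
  fixes s L \<alpha> :: real and \<tau> \<eta> \<theta> \<omega> :: "nat \<Rightarrow> real"
  assumes s1: "1 \<le> s" and L: "L = s\<^sup>2 * \<alpha>" and \<alpha>: "0 < \<alpha>"
    and \<tau>: "\<And>t. 1 \<le> t \<Longrightarrow> \<tau> t = min ((real t - 1) / 2) s"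
    and \<eta>: "\<And>t. 1 \<le> t \<Longrightarrow> \<eta> t = L / \<tau> (t + 1)"
    and \<theta>: "\<And>t. 1 \<le> t \<Longrightarrow> \<theta> t = \<tau> t / (\<tau> (t - 1) + 1)"
    and \<omega>1: "\<omega> 1 = 1" and \<omega>: "\<And>t. 2 \<le> t \<Longrightarrow> \<omega> t = \<omega> (t - 1) / \<theta> t"
begin

definition W :: "nat \<Rightarrow> real" where "W t = (\<Sum>i=1..t. \<omega> i)"

lemma L_pos: "0 < L"
  using s1 L \<alpha> by simp

lemma W_0 [simp]: "W 0 = 0"
  by (simp add: W_def)

lemma W_Suc: "W (Suc t) = W t + \<omega> (Suc t)"
  by (simp add: W_def)

lemma \<tau>_1 [simp]: "\<tau> (Suc 0) = 0"
  using \<tau>[of 1] s1 by simp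

lemma \<tau>_nonneg: "1 \<le> t \<Longrightarrow> 0 \<le> \<tau> t"
  using \<tau> s1 by simp

lemma \<tau>_pos: "2 \<le> t \<Longrightarrow> 0 < \<tau> t"
  using \<tau> s1 by simp

lemma \<omega>_Suc: assumes "1 \<le> t" shows "\<omega> (Suc t) = \<omega> t * (1 + \<tau> t) / \<tau> (Suc t)"
  using \<omega>[of "Suc t"] \<theta>[of "Suc t"] assms by (simp add: add.commute)

lemma \<omega>_pos: "1 \<le> t \<Longrightarrow> 0 < \<omega> t"
proof (induction t rule: dec_induct)
  case (step t)
  then show ?case using \<tau>_nonneg[of t] \<tau>_pos[of "Suc t"] by (simp add: \<omega>_Suc)
qed (use \<omega>1 in simp)

lemma W_eq: "1 \<le> t \<Longrightarrow> W t = \<omega> t * (1 + \<tau> t)"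
proof (induction t rule: dec_induct)
  case base
  show ?case using \<omega>1 by (simp add: W_def)
next
  case (step t)
  then show ?case using \<tau>_pos[of "Suc t"] by (simp add: W_Suc \<omega>_Suc field_simps)
qed

lemma W_eq_pred: "1 \<le> t \<Longrightarrow> W t = \<omega> (Suc t) * \<tau> (Suc t)"
  using W_eq[of t] \<tau>_pos[of "Suc t"] by (simp add: \<omega>_Suc)

lemma W_pos: "1 \<le> t \<Longrightarrow> 0 < W t"
  using W_eq[of t] \<omega>_pos[of t] \<tau>_nonneg[of t] by simp

lemma W_nonneg: "0 \<le> W t"
  using W_pos[of t] by (cases t) auto

text \<open>The proximal term of a step must absorb the error of the quadratic model. Since
  \<open>\<eta> t = L / \<tau> (t + 1)\<close>, this says that \<open>\<tau>\<close> increases by at most one per step; it in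
  fact increases by at most \<open>1 / 2\<close>.\<close>

lemma \<eta>_smoothness: assumes "1 \<le> t" shows "L * \<omega> t \<le> \<eta> t * W t"
proof -
  have "\<tau> (Suc t) \<le> 1 + \<tau> t" using \<tau>[of t] \<tau>[of "Suc t"] assms
    by (auto simp: min_def field_simps)
  then have "1 \<le> (1 + \<tau> t) / \<tau> (Suc t)" using \<tau>_pos[of "Suc t"] assms by simp
  then have "L * \<omega> t * 1 \<le> L * \<omega> t * ((1 + \<tau> t) / \<tau> (Suc t))"
    using L_pos \<omega>_pos[OF assms] by (intro mult_left_mono) auto
  then show ?thesis using assms by (simp add: \<eta> W_eq)
qed

text \<open>While \<open>\<tau>\<close> grows linearly, two steps increase it by exactly one and the inequality
  already holds with the last factor replaced by \<open>1\<close>. Once \<open>\<tau> (t + 1)\<close> has reached \<open>s\<close>,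
  the right-hand side is \<open>s + 1\<close>, and \<open>\<tau> t \<le> s\<close>. In between, at most one half is lost by
  truncating \<open>\<tau> (t + 2)\<close> to \<open>s\<close>, and the last factor restores it.\<close>

lemma \<tau>_step: assumes "1 \<le> t"
  shows "1 + \<tau> t \<le> \<tau> (Suc (Suc t)) * (1 + \<tau> (Suc t) / s\<^sup>2)"
proof -
  define r where "r = real t"
  have r: "1 \<le> r" using assms by (simp add: r_def)
  have t0: "\<tau> t = min ((r - 1) / 2) s" and t1: "\<tau> (Suc t) = min (r / 2) s"
    and t2: "\<tau> (Suc (Suc t)) = min ((r + 1) / 2) s"
    using \<tau>[of t] \<tau>[of "Suc t"] \<tau>[of "Suc (Suc t)"] assms by (simp_all add: r_def add.commute)
  consider "r + 1 \<le> 2 * s" | "r \<le> 2 * s" "2 * s < r + 1" | "2 * s < r" by linarith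
  then show ?thesis
  proof cases
    case 1
    then have "1 + \<tau> t = \<tau> (Suc (Suc t)) * 1" using t0 t2 by simp
    also have "\<dots> \<le> \<tau> (Suc (Suc t)) * (1 + \<tau> (Suc t) / s\<^sup>2)"
      using \<tau>_nonneg[of "Suc t"] \<tau>_nonneg[of "Suc (Suc t)"] by (intro mult_left_mono) auto
    finally show ?thesis .
  next
    case 2
    have "\<tau> t = (r - 1) / 2" and v: "\<tau> (Suc t) = r / 2" "\<tau> (Suc (Suc t)) = s"
      using 2 t0 t1 t2 by simp_all
    then have "1 + \<tau> t \<le> s + 1 / 2" using 2 by simp
    also have "1 / 2 \<le> r / (2 * s)" using 2 r s1 by (simp add: field_simps)
    also have "s + r / (2 * s) = s * (1 + r / 2 / s\<^sup>2)"
      using s1 by (simp add: field_simps power2_eq_square)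
    finally show ?thesis unfolding v by simp
  next
    case 3
    then show ?thesis using t0 t1 t2 s1 by (simp add: field_simps power2_eq_square)
  qed
qed

text \<open>The distance term gained by a step, which includes the strong convexity of \<open>u\<close>, must cover
  the one that the next step costs; only then do the step estimates telescope.\<close>

lemma \<eta>_strong_convexity: assumes "1 \<le> t"
  shows "\<omega> (Suc t) * \<eta> (Suc t) \<le> \<omega> t * (\<eta> t + \<alpha>)"
proof -
  define a b where "a = \<tau> (Suc t)" and "b = \<tau> (Suc (Suc t))"
  have a: "0 < a" and b: "0 < b" using \<tau>_pos assms by (simp_all add: a_def b_def)
  have "\<omega> (Suc t) * \<eta> (Suc t) = \<omega> t * (L / (a * b)) * (1 + \<tau> t)"
    using assms a by (simp add: \<omega>_Suc \<eta> a_def b_def)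
  also have "\<dots> \<le> \<omega> t * (L / (a * b)) * (b * (1 + a / s\<^sup>2))"
    using \<tau>_step[OF assms] \<omega>_pos[OF assms] L_pos a b
    by (intro mult_left_mono) (auto simp: a_def b_def)
  also have "\<dots> = \<omega> t * (\<eta> t + \<alpha>)"
    using a b s1 assms by (simp add: \<eta> L field_simps flip: a_def)
  finally show ?thesis .
qed

text \<open>The new weight is \<open>W t / \<tau> (t + 1)\<close>. The two bounds on \<open>\<tau> (t + 1)\<close>, by \<open>s\<close> and
  by \<open>t / 2\<close>, give the geometric and the quadratic growth of \<open>W\<close>, and both hold at every
  step.\<close>

lemma W_growth: assumes "1 \<le> t" shows "(1 + 1 / s) * W t \<le> W (Suc t)"
    and "real (t + 2) * W t \<le> real t * W (Suc t)"
proof -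
  have p: "0 < \<tau> (Suc t)" using \<tau>_pos assms by simp
  have w: "W (Suc t) = W t + W t / \<tau> (Suc t)"
    using W_eq_pred[OF assms] p by (simp add: W_Suc)
  have "1 / s \<le> 1 / \<tau> (Suc t)" using p \<tau>[of "Suc t"] by (intro divide_left_mono) auto
  then have "W t * (1 / s) \<le> W t * (1 / \<tau> (Suc t))"
    using W_nonneg by (intro mult_left_mono)
  then show "(1 + 1 / s) * W t \<le> W (Suc t)" unfolding w by (simp add: algebra_simps)
  have "\<tau> (Suc t) \<le> real t / 2" using \<tau>[of "Suc t"] by simp
  then have "2 \<le> real t * (1 / \<tau> (Suc t))" using p by (simp add: field_simps)
  then have "W t * 2 \<le> W t * (real t * (1 / \<tau> (Suc t)))"
    using W_nonneg by (intro mult_left_mono)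
  then show "real (t + 2) * W t \<le> real t * W (Suc t)" unfolding w by (simp add: algebra_simps)
qed

lemma W_quadratic: "real t * (real t + 1) / 2 \<le> W t"
proof (cases "t = 0")
  case False
  then have "1 \<le> t" by simp
  then show ?thesis
  proof (induction t rule: dec_induct)
    case base
    show ?case using \<omega>1 by (simp add: W_def)
  next
    case (step t)
    have "real t * (real (Suc t) * (real (Suc t) + 1) / 2) = real (t + 2) * (real t * (real t + 1) / 2)"
      by (simp add: algebra_simps)
    also have "\<dots> \<le> real (t + 2) * W t" using step.IH by (intro mult_left_mono) auto
    also have "\<dots> \<le> real t * W (Suc t)" using W_growth(2) step.hyps by simp
    finally show ?case using step.hyps by (simp add: mult_le_cancel_left_pos)
  qed
qed simp

lemma W_geometric: assumes "1 \<le> t" shows "(1 + 1 / s) ^ k * W t \<le> W (t + k)"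
proof (induction k)
  case (Suc k)
  have "(1 + 1 / s) ^ Suc k * W t = (1 + 1 / s) * ((1 + 1 / s) ^ k * W t)" by simp
  also have "\<dots> \<le> (1 + 1 / s) * W (t + k)" using Suc s1 by (intro mult_left_mono) auto
  also have "\<dots> \<le> W (t + Suc k)" using W_growth(1)[of "t + k"] assms by simp
  finally show ?case .
qed simp

text \<open>Bounding \<open>exp\<close> from below by its tangent at \<open>0\<close>, at the negative argument
  \<open>- 1 / (s + 1)\<close>, gives an upper bound for \<open>exp (1 / (s + 1))\<close> that is exactly
  \<open>1 + 1 / s\<close>.\<close>

lemma exp_le_one_plus_power: "exp (real k / (s + 1)) \<le> (1 + 1 / s) ^ k"
proof -
  have "1 - 1 / (s + 1) \<le> exp (- (1 / (s + 1)))"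
    using exp_ge_add_one_self[of "- (1 / (s + 1))"] by simp
  then have "exp (1 / (s + 1)) \<le> 1 / (1 - 1 / (s + 1))"
    using s1 by (simp add: exp_minus field_simps)
  also have "\<dots> = 1 + 1 / s" using s1 by (simp add: field_simps)
  finally have "exp (1 / (s + 1)) ^ k \<le> (1 + 1 / s) ^ k" by (intro power_mono) auto
  then show ?thesis by (simp add: exp_of_nat_mult[symmetric])
qed

text \<open>The accumulated weight needed for a given accuracy will be \<open>s * (exp y - 1)\<close>. If \<open>N\<close> is
  small, then \<open>y\<close> is at most \<open>sqrt 2\<close>, and quadratic growth suffices because
  \<open>exp y - 1\<close> is bounded by a quadratic polynomial there. Otherwise, quadratic growth up to
  the time \<open>T\<close> around which \<open>\<tau>\<close> saturates gives a weight of order \<open>s\<^sup>2\<close>, and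
  the remaining steps multiply it geometrically. The \<open>2 * s\<close> steps spent before \<open>T\<close> cost a
  factor of about \<open>exp 2\<close>, which is made up for by the quotient of that weight and \<open>s\<close>, at
  least \<open>2 * s + 1\<close>, together with the additive \<open>4\<close> in the iteration count.\<close>

lemma W_exponential:
  assumes y: "0 \<le> y" and N: "(sqrt 2 * s + 1) * y + 4 \<le> real N"
  shows "s * (exp y - 1) \<le> W N"
proof (cases "real N < 2 * s + 1")
  case True
  have sq: "1.4 \<le> sqrt 2" by (rule real_le_rsqrt) (simp add: power2_eq_square)
  have sy: "0 \<le> s * y" using y s1 by simp
  have N1: "sqrt 2 * (s * y) + 4 \<le> real N" using N y by (simp add: algebra_simps)
  have "sqrt 2 * (s * sqrt 2) = 2 * s" by simp
  then have "sqrt 2 * (s * y) \<le> sqrt 2 * (s * sqrt 2)" using N1 True by linarith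
  then have "y \<le> sqrt 2" using s1 by simp
  also have "sqrt 2 \<le> 3 / 2" by (rule real_le_lsqrt) (simp_all add: power2_eq_square)
  finally have y3: "y \<le> 3 / 2" .
  \<comment> \<open>Halving brings the argument below \<open>1\<close>, the range of the quadratic bound \<open>exp_bound\<close>.\<close>
  have "exp y = (exp (y / 2))\<^sup>2" by (simp add: power2_eq_square flip: exp_add)
  also have "\<dots> \<le> (1 + y / 2 + (y / 2)\<^sup>2)\<^sup>2"
    using exp_bound[of "y / 2"] y y3 by (intro power_mono) auto
  also have "\<dots> \<le> 1 + 5 * y + y\<^sup>2"
  proof -
    have p2: "y * y \<le> y * (3 / 2)" using y y3 by (intro mult_left_mono)
    then have "y * y * y \<le> y * (3 / 2) * y" using y by (intro mult_right_mono)
    with p2 have p3: "y * y * y \<le> y * (9 / 4)" by simp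
    then have "y * y * y * y \<le> y * (9 / 4) * y" using y by (intro mult_right_mono)
    with p2 have "y * y * y * y \<le> y * (27 / 8)" by simp
    moreover have "(1 + y / 2 + (y / 2)\<^sup>2)\<^sup>2
        = 1 + y + 3 / 4 * (y * y) + 1 / 4 * (y * y * y) + 1 / 16 * (y * y * y * y)"
      by (simp add: power2_eq_square field_simps)
    moreover have "0 \<le> y\<^sup>2" by simp
    ultimately show ?thesis using p2 p3 y by linarith
  qed
  finally have e: "exp y - 1 \<le> 5 * y + y\<^sup>2" by simp
  have "s * (exp y - 1) \<le> s * (5 * y + y\<^sup>2)" using e s1 by simp
  also have "\<dots> \<le> 5 * (s * y) + (s * y)\<^sup>2"
  proof -
    have "s * 1 * y\<^sup>2 \<le> s * s * y\<^sup>2" using s1 by (intro mult_right_mono mult_left_mono) auto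
    then show ?thesis by (simp add: power2_eq_square algebra_simps)
  qed
  also have "\<dots> \<le> (sqrt 2 * (s * y) + 4)\<^sup>2 / 2"
  proof -
    have "5 * (s * y) \<le> 4 * sqrt 2 * (s * y)" using sq sy by (intro mult_right_mono) auto
    then show ?thesis by (simp add: power2_eq_square algebra_simps)
  qed
  also have "\<dots> \<le> (real N)\<^sup>2 / 2" using N1 sy by (intro divide_right_mono power_mono) auto
  also have "\<dots> \<le> W N" using W_quadratic[of N] by (simp add: power2_eq_square algebra_simps)
  finally show ?thesis .
next
  case False
  define T where "T = nat \<lfloor>2 * s + 1\<rfloor>"
  have T: "2 * s < real T" "real T \<le> 2 * s + 1"
    using s1 by (simp_all add: T_def)
  then have "T \<le> N" "1 \<le> T" using False s1 by linarith+
  define k where "k = N - T"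
  have Nk: "N = T + k" using \<open>T \<le> N\<close> by (simp add: k_def)
  have k: "(sqrt 2 * s + 1) * y + 3 - 2 * s \<le> real k" using N T Nk by simp
  have "y + 5 / (s + 1) - 2 \<le> real k / (s + 1)"
  proof -
    have "s * y \<le> sqrt 2 * s * y" using s1 y by (simp add: mult_right_mono)
    then have "(s + 1) * y + 3 - 2 * s \<le> real k" using k by (simp add: algebra_simps)
    then have "((s + 1) * y + 3 - 2 * s) / (s + 1) \<le> real k / (s + 1)"
      using s1 by (intro divide_right_mono) auto
    moreover have "((s + 1) * y + 3 - 2 * s) / (s + 1) = y + 5 / (s + 1) - 2"
      using s1 by (simp add: field_simps)
    ultimately show ?thesis by simp
  qed
  then have "exp (y + 5 / (s + 1) - 2) \<le> (1 + 1 / s) ^ k"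
    using exp_le_one_plus_power[of k] by (meson exp_le_cancel_iff order_trans)
  then have growth: "exp y * exp (5 / (s + 1)) \<le> exp 2 * (1 + 1 / s) ^ k"
    by (simp add: exp_add exp_diff field_simps)
  \<comment> \<open>The \<open>9\<close> is the bound on \<open>exp 2\<close>. For large \<open>s\<close> the first factor suffices; for \<open>s\<close> near \<open>1\<close> the second one is
    needed, which is where the additive constant enters.\<close>
  have "9 \<le> (2 * s + 1) * exp (5 / (s + 1))"
  proof -
    have "0 \<le> (s - 1) * (2 * s + 6)" using s1 by simp
    then have "9 \<le> (2 * s + 1) * (1 + 5 / (s + 1))"
      using s1 by (simp add: field_simps)
    also have "\<dots> \<le> (2 * s + 1) * exp (5 / (s + 1))"
      using s1 exp_ge_add_one_self[of "5 / (s + 1)"] by (intro mult_left_mono) auto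
    finally show ?thesis .
  qed
  then have "exp 2 * exp y \<le> (2 * s + 1) * exp (5 / (s + 1)) * exp y"
    using exp_two_le by (intro mult_right_mono) auto
  also have "\<dots> \<le> (2 * s + 1) * (exp 2 * (1 + 1 / s) ^ k)"
    using growth s1 by (simp add: mult_ac)
  finally have "exp 2 * exp y \<le> exp 2 * ((2 * s + 1) * (1 + 1 / s) ^ k)" by (simp add: mult_ac)
  then have "exp y \<le> (2 * s + 1) * (1 + 1 / s) ^ k" by simp
  then have "s * (exp y - 1) \<le> s * ((2 * s + 1) * (1 + 1 / s) ^ k)"
    using s1 by (intro mult_left_mono) auto
  also have "\<dots> = (1 + 1 / s) ^ k * (2 * s * (2 * s + 1) / 2)" by simp
  also have "\<dots> \<le> (1 + 1 / s) ^ k * (real T * (real T + 1) / 2)"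
    using T s1 by (intro mult_left_mono divide_right_mono mult_mono) auto
  also have "\<dots> \<le> (1 + 1 / s) ^ k * W T"
    using W_quadratic[of T] s1 by (intro mult_left_mono) auto
  also have "\<dots> \<le> W N" using W_geometric[OF \<open>1 \<le> T\<close>] Nk by simp
  finally show ?thesis .
qed

text \<open>The first alternative for \<open>N\<close> is the quadratic growth of \<open>W\<close>. The second is its
  geometric growth: \<open>sqrt (L * \<alpha>) = s * \<alpha>\<close> turns the target into \<open>s * A\<close>, where
  \<open>A + 1\<close> is the argument of the logarithm.\<close>

lemma iteration_count:
  assumes c: "1 \<le> c" and \<epsilon>: "0 < \<epsilon>" and R: "0 \<le> R"
    and N: "min (sqrt (2 * c * L / \<epsilon>) * R)
      ((sqrt (2 * L / \<alpha>) + 1) * ln (c * sqrt (L * \<alpha>) * R\<^sup>2 / \<epsilon> + 1) + 4) \<le> real N"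
  shows "c * (L * R\<^sup>2) / \<epsilon> \<le> W N"
proof -
  consider "sqrt (2 * c * L / \<epsilon>) * R \<le> real N"
    | "(sqrt (2 * L / \<alpha>) + 1) * ln (c * sqrt (L * \<alpha>) * R\<^sup>2 / \<epsilon> + 1) + 4 \<le> real N"
    using N by (auto simp: min_le_iff_disj)
  then show ?thesis
  proof cases
    case 1
    have "0 \<le> 2 * c * L / \<epsilon>" using c \<epsilon> L_pos by simp
    moreover have "(sqrt (2 * c * L / \<epsilon>) * R)\<^sup>2 \<le> (real N)\<^sup>2"
      using 1 R calculation by (intro power_mono) auto
    ultimately have "2 * c * L / \<epsilon> * R\<^sup>2 \<le> (real N)\<^sup>2" by (simp add: power_mult_distrib)
    then have "c * (L * R\<^sup>2) / \<epsilon> \<le> (real N)\<^sup>2 / 2" by (simp add: mult_ac)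
    also have "\<dots> \<le> W N" using W_quadratic[of N] by (simp add: power2_eq_square algebra_simps)
    finally show ?thesis .
  next
    case 2
    define A where "A = c * sqrt (L * \<alpha>) * R\<^sup>2 / \<epsilon>"
    have A: "0 \<le> A" using c \<epsilon> L_pos \<alpha> by (simp add: A_def)
    have "L * \<alpha> = (s * \<alpha>)\<^sup>2" by (simp add: L power2_eq_square)
    then have La: "sqrt (L * \<alpha>) = s * \<alpha>" using s1 \<alpha> by simp
    have "2 * L / \<alpha> = 2 * s\<^sup>2" using \<alpha> by (simp add: L)
    then have L\<alpha>: "sqrt (2 * L / \<alpha>) = sqrt 2 * s" using s1 by (simp add: real_sqrt_mult)
    have "c * (L * R\<^sup>2) / \<epsilon> = s * A"
      unfolding A_def La by (simp add: L power2_eq_square)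
    also have "\<dots> = s * (exp (ln (A + 1)) - 1)" using A by simp
    also have "\<dots> \<le> W N"
      using A 2 by (intro W_exponential) (simp_all add: A_def[symmetric] L\<alpha>)
    finally show ?thesis .
  qed
qed

section \<open>The gap of the averages\<close>

lemma \<theta>_\<omega>: assumes "1 \<le> t" shows "\<omega> (Suc t) * \<theta> (Suc t) = \<omega> t"
  using \<tau>_pos[of "Suc t"] \<tau>_nonneg[of t] assms \<theta>[of "Suc t"]
  by (simp add: \<omega>_Suc add.commute)

definition avg :: "(nat \<Rightarrow> 'a::real_vector) \<Rightarrow> nat \<Rightarrow> 'a"
  where "avg x t = (1 / W t) *\<^sub>R (\<Sum>i=1..t. \<omega> i *\<^sub>R x i)"

lemma W_avg: "W t *\<^sub>R avg x t = (\<Sum>i=1..t. \<omega> i *\<^sub>R x i)"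
  using W_pos[of t] by (cases "t = 0") (auto simp: avg_def)

lemma W_avg_Suc: "W (Suc t) *\<^sub>R avg x (Suc t) = W t *\<^sub>R avg x t + \<omega> (Suc t) *\<^sub>R x (Suc t)"
  by (simp add: W_avg)

lemma avg_in_convex:
  assumes "convex X" "\<And>i. \<lbrakk>1 \<le> i; i \<le> t\<rbrakk> \<Longrightarrow> x i \<in> X" "1 \<le> t"
  shows "avg x t \<in> X"
proof -
  have "(\<Sum>i=1..t. (\<omega> i / W t) *\<^sub>R x i) \<in> X"
  proof (rule convex_sum)
    show "(\<Sum>i=1..t. \<omega> i / W t) = 1"
      using W_pos[OF assms(3)] by (simp add: W_def flip: sum_divide_distrib)
    show "0 \<le> \<omega> i / W t" if "i \<in> {1..t}" for i
      using that \<omega>_pos[of i] W_nonneg[of t] by simp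
  qed (use assms in auto)
  then show ?thesis by (simp add: avg_def scaleR_sum_right)
qed

text \<open>The extrapolation and averaging rules of the method amount to Nesterov's choice of
  linearization point. Multiplied by \<open>W (t + 1) = \<omega> (t + 1) * (1 + \<tau> (t + 1))\<close>, the update
  says that \<open>W t *\<^sub>R xu t\<close> changes by \<open>\<omega> (t + 1) *\<^sub>R x t + \<omega> t *\<^sub>R (x t - x (t - 1))\<close>,
  and the right-hand side of the claim changes by the same vector. No multiplier occurs in this
  identity, so it serves all Lagrangians simultaneously.\<close>

lemma linearization_point_eq:
  fixes x xu :: "nat \<Rightarrow> real^'n"
  assumes it: "acgd_iterates X f g u \<theta> \<eta> \<tau> N x xu"
  shows "Suc t \<le> N \<Longrightarrow>
    W (Suc t) *\<^sub>R xu (Suc t) = W t *\<^sub>R avg x t + \<omega> (Suc t) *\<^sub>R x t"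
proof (induction t)
  case 0
  have "xu 1 = (1 / (1 + \<tau> 1)) *\<^sub>R (\<tau> 1 *\<^sub>R xu 0 + (x 0 + \<theta> 1 *\<^sub>R (x 0 - x 0)))"
    using it 0 by (auto simp: acgd_iterates_def Let_def)
  then show ?case by (simp add: W_Suc)
next
  case (Suc t)
  let ?t = "Suc (Suc t)"
  have p: "0 < 1 + \<tau> ?t" using \<tau>_nonneg[of ?t] by simp
  have "xu ?t = (1 / (1 + \<tau> ?t)) *\<^sub>R (\<tau> ?t *\<^sub>R xu (Suc t)
      + (x (Suc t) + \<theta> ?t *\<^sub>R (x (Suc t) - x t)))"
    using it Suc.prems by (auto simp: acgd_iterates_def Let_def dest!: bspec[of _ _ ?t])
  then have "(\<omega> ?t * (1 + \<tau> ?t)) *\<^sub>R xu ?t = \<omega> ?t *\<^sub>R (\<tau> ?t *\<^sub>R xu (Suc t)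
      + (x (Suc t) + \<theta> ?t *\<^sub>R (x (Suc t) - x t)))"
    using p by simp
  then have "W ?t *\<^sub>R xu ?t = W (Suc t) *\<^sub>R xu (Suc t) + \<omega> ?t *\<^sub>R x (Suc t)
      + \<omega> (Suc t) *\<^sub>R (x (Suc t) - x t)"
    using \<theta>_\<omega>[of "Suc t"] W_eq_pred[of "Suc t"] W_eq[of ?t]
    by (simp add: scaleR_add_right add.assoc)
  also have "\<dots> = W t *\<^sub>R avg x t + \<omega> (Suc t) *\<^sub>R x (Suc t) + \<omega> ?t *\<^sub>R x (Suc t)"
    using Suc by (simp add: scaleR_diff_right)
  also have "\<dots> = W (Suc t) *\<^sub>R avg x (Suc t) + \<omega> ?t *\<^sub>R x (Suc t)"
    by (simp only: W_avg_Suc)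
  finally show ?case .
qed

text \<open>The potential is the weighted gap of the average plus a multiple of the squared distance of the
  iterate from \<open>z\<close>. It does not increase, and its value after one step is bounded by
  \<open>L * (norm (x 0 - z))\<^sup>2\<close>.\<close>

theorem lagrangian_gap_bound:
  fixes x xu :: "nat \<Rightarrow> real^'n" and g :: "real^'n \<Rightarrow> real^'m"
  assumes it: "acgd_iterates X f g u \<theta> \<eta> \<tau> N x xu" and N: "1 \<le> N"
    and u: "convex_on X u" "strongly_convex_on X \<alpha> u"
    and f: "convex_on UNIV f" "\<And>y. f differentiable (at y)"
    and g: "\<And>i. convex_on UNIV (\<lambda>y. g y $ i)" "\<And>i y. (\<lambda>y. g y $ i) differentiable (at y)"
    and z: "z \<in> X" "g z \<le> 0" and l: "0 \<le> l"
    and lip: "lipschitz_gradient C (lagrangian f g l)" "C \<le> L"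
  shows "W N * (f (avg x N) + u (avg x N) + inner l (g (avg x N)) - (f z + u z))
    \<le> L * (norm (x 0 - z))\<^sup>2"
proof -
  define h where "h = lagrangian f g l"
  define V where "V = f z + u z"
  have h: "convex_on UNIV h" "lipschitz_gradient C h"
    using convex_on_lagrangian[OF f(1) g(1) l] lip by (simp_all add: h_def)
  have step: "acgd_step X f g u (\<eta> (Suc t)) (xu (Suc t)) (x t) (x (Suc t))" if "Suc t \<le> N" for t
  proof -
    have "Suc t \<in> {1..N}" using that by simp
    then have "acgd_step X f g u (\<eta> (Suc t)) (xu (Suc t)) (x (Suc t - 1)) (x (Suc t))"
      using it unfolding acgd_iterates_def Let_def by blast
    then show ?thesis by simp
  qed
  have xX: "x t \<in> X" if "t \<le> N" for t
  proof (cases t)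
    case 0
    then show ?thesis using it by (simp add: acgd_iterates_def)
  next
    case (Suc k)
    then show ?thesis using step[of k] that by (auto simp: acgd_step_def saddle_point_def)
  qed
  have X: "convex X" using u(2) by (simp add: strongly_convex_on_def)
  \<comment> \<open>Stated for any \<open>q\<close> with the weighted value of the average, because the average of
    no iterates is \<open>0\<close>, which need not lie in \<open>X\<close>; the first step uses \<open>q = x 0\<close>.\<close>
  have potential: "W (Suc t) * (h (avg x (Suc t)) + u (avg x (Suc t)) - V)
        + \<omega> (Suc t) * (\<eta> (Suc t) + \<alpha>) / 2 * (norm (z - x (Suc t)))\<^sup>2
      \<le> W t * (h q + u q - V) + \<omega> (Suc t) * \<eta> (Suc t) / 2 * (norm (z - x t))\<^sup>2"
    if t: "Suc t \<le> N" and q: "q \<in> X" "W t *\<^sub>R q = W t *\<^sub>R avg x t" for t q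
    unfolding W_Suc
  proof (rule accelerated_potential_decrease[OF h u(1) lip(2) xX[OF t] q(1)])
    show "0 \<le> W t" "0 < \<omega> (Suc t)" using W_nonneg \<omega>_pos by simp_all
    show "L * \<omega> (Suc t) \<le> \<eta> (Suc t) * (W t + \<omega> (Suc t))"
      using \<eta>_smoothness[of "Suc t"] by (simp add: W_Suc)
    show "(W t + \<omega> (Suc t)) *\<^sub>R xu (Suc t) = W t *\<^sub>R q + \<omega> (Suc t) *\<^sub>R x t"
      using linearization_point_eq[OF it t] by (simp only: W_Suc q(2))
    show "(W t + \<omega> (Suc t)) *\<^sub>R avg x (Suc t) = W t *\<^sub>R q + \<omega> (Suc t) *\<^sub>R x (Suc t)"
      using W_avg_Suc[of t x] by (simp only: W_Suc q(2))
    show "h (xu (Suc t)) + inner (gradient h (xu (Suc t))) (x (Suc t) - xu (Suc t)) + u (x (Suc t))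
        + \<eta> (Suc t) / 2 * (norm (x (Suc t) - x t))\<^sup>2
        + (\<eta> (Suc t) + \<alpha>) / 2 * (norm (z - x (Suc t)))\<^sup>2
      \<le> V + \<eta> (Suc t) / 2 * (norm (z - x t))\<^sup>2"
      unfolding h_def V_def
      by (rule acgd_step_model_inequality[OF step[OF t] u(2) f g z l])
  qed
  have invariant: "W (Suc t) * (h (avg x (Suc t)) + u (avg x (Suc t)) - V)
        + \<omega> (Suc t) * (\<eta> (Suc t) + \<alpha>) / 2 * (norm (z - x (Suc t)))\<^sup>2
      \<le> L * (norm (z - x 0))\<^sup>2" if "Suc t \<le> N" for t
    using that
  proof (induction t)
    case 0
    have "\<eta> (Suc 0) = 2 * L"
      using \<eta>[of 1] \<tau>[of 2] s1 by (simp add: numeral_2_eq_2[symmetric])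
    then show ?case
      using potential[of 0 "x 0"] xX[of 0] 0 \<omega>1 by simp
  next
    case (Suc t)
    have "avg x (Suc t) \<in> X"
      using X xX Suc.prems by (intro avg_in_convex) auto
    note potential[OF Suc.prems this refl]
    moreover have "\<omega> (Suc (Suc t)) * \<eta> (Suc (Suc t)) / 2 * (norm (z - x (Suc t)))\<^sup>2
        \<le> \<omega> (Suc t) * (\<eta> (Suc t) + \<alpha>) / 2 * (norm (z - x (Suc t)))\<^sup>2"
      using \<eta>_strong_convexity[of "Suc t"] by (intro mult_right_mono divide_right_mono) auto
    ultimately show ?case using Suc by simp
  qed
  obtain t where t: "N = Suc t" using N by (cases N) auto
  have "0 < \<tau> (Suc N)" using \<tau>_pos N by simp
  then have "0 \<le> \<eta> N" using \<eta>[of N] N L_pos by simp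
  then have "0 \<le> \<omega> N * (\<eta> N + \<alpha>) / 2 * (norm (z - x N))\<^sup>2"
    using \<omega>_pos[OF N] \<alpha> by simp
  with invariant[of t] t have "W N * (h (avg x N) + u (avg x N) - V) \<le> L * (norm (z - x 0))\<^sup>2"
    by force
  then show ?thesis
    by (simp add: h_def V_def lagrangian_eq_inner norm_minus_commute[of z] add_ac)
qed

end

section \<open>Accuracy of the averages\<close>

theorem corollary2:
  fixes X :: "(real^'n) set"
    and f u F :: "real^'n \<Rightarrow> real"
    and g :: "real^'n \<Rightarrow> real^'m"
    and xstar :: "real^'n" and lstar :: "real^'m"
    and Lip :: "real^'m \<Rightarrow> real"
    and \<alpha> c \<epsilon> L1 \<kappa>1 :: real
    and \<tau> \<eta> \<theta> \<omega> :: "nat \<Rightarrow> real"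
    and x xu :: "nat \<Rightarrow> real^'n" and xbar :: "real^'n"
    and N :: nat
  assumes "\<alpha> > 0" and "c \<ge> 1" and "\<epsilon> > 0"
    and "closed X" and "convex X"
    and "convex_on UNIV f" and "\<exists>C. lipschitz_gradient C f"
    and "\<forall>i. convex_on UNIV (\<lambda>y. g y $ i)"
    and "\<forall>i. \<exists>C. lipschitz_gradient C (\<lambda>y. g y $ i)"
    and "convex_on X u" and "strongly_convex_on X \<alpha> u"
    and "F = (\<lambda>y. f y + u y)"
    and "optimal_solution X F g xstar" and "KKT_pair X f g u xstar lstar"
    and "\<forall>l\<ge>0. lipschitz_gradient (Lip l) (\<lambda>y. f y + (\<Sum>i\<in>UNIV. l $ i * g y $ i))"
    and "bdd_above (Lip ` multiplier_region lstar 1)"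
    and "Lip 0 \<ge> \<alpha>"
    and "L1 = aggregate_smoothness Lip (multiplier_region lstar 1)"
    and "\<kappa>1 = L1 / \<alpha>"
    and "\<forall>t\<ge>1. \<tau> t = min ((real t - 1) / 2) (sqrt \<kappa>1)"
    and "\<forall>t\<ge>1. \<eta> t = L1 / \<tau> (t + 1)"
    and "\<forall>t\<ge>1. \<theta> t = \<tau> t / (\<tau> (t - 1) + 1)"
    and "\<omega> 1 = 1" and "\<forall>t\<ge>2. \<omega> t = \<omega> (t - 1) / \<theta> t"
    and "N \<ge> 1"
    and "acgd_iterates X f g u \<theta> \<eta> \<tau> N x xu"
    and "xbar = (1 / (\<Sum>t=1..N. \<omega> t)) *\<^sub>R (\<Sum>t=1..N. \<omega> t *\<^sub>R x t)"
    and "real N \<ge> min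
           (sqrt (2 * max c 1 * L1 / \<epsilon>) * norm (x 0 - xstar))
           ((sqrt (2 * L1 / \<alpha>) + 1)
              * ln (max c 1 * sqrt (L1 * \<alpha>) * (norm (x 0 - xstar))\<^sup>2 / \<epsilon> + 1) + 4)"
  shows "F xbar - F xstar \<le> \<epsilon> \<and> norm (pos_part (g xbar)) \<le> \<epsilon> / c"
proof -
  have f: "convex_on UNIV f" "\<And>y. f differentiable (at y)"
    and g: "\<And>i. convex_on UNIV (\<lambda>y. g y $ i)" "\<And>i y. (\<lambda>y. g y $ i) differentiable (at y)"
    using assms(6-9) by (auto simp: lipschitz_gradient_def)
  have lip: "lipschitz_gradient (Lip l) (lagrangian f g l)" if "0 \<le> l" for l
    using assms(15) that by (simp add: lagrangian_def[abs_def])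
  have Lip_le: "Lip l \<le> L1" if "l \<in> multiplier_region lstar 1" for l
    unfolding assms(18) aggregate_smoothness_def by (rule cSUP_upper[OF that assms(16)])
  have "Lip 0 \<le> L1" by (rule Lip_le) (simp add: multiplier_region_def)
  then have \<kappa>: "1 \<le> \<kappa>1" using assms(1,17,19) by simp
  interpret acgd_schedule "sqrt \<kappa>1" L1 \<alpha> \<tau> \<eta> \<theta> \<omega>
    using assms(1,19-24) \<kappa> by unfold_locales auto
  have xbar: "xbar = avg x N" by (simp add: assms(27) avg_def W_def)
  have xs: "xstar \<in> X" "g xstar \<le> 0" and ls: "0 \<le> lstar"
    using assms(14) by (auto simp: KKT_pair_def)
  define R where "R = norm (x 0 - xstar)"
  have WN: "0 < W N" using W_pos assms(25) by simp
  have "c * (L1 * R\<^sup>2) / \<epsilon> \<le> W N"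
    using iteration_count[of c \<epsilon> R N] assms(2,3,28) by (simp add: R_def max_absorb1)
  then have LR: "L1 * R\<^sup>2 \<le> W N * (\<epsilon> / c)" using assms(2,3) by (simp add: field_simps)
  have gap: "F xbar + inner l (g xbar) - F xstar \<le> \<epsilon> / c"
    if "0 \<le> l" "l \<in> multiplier_region lstar 1" for l
  proof -
    have "W N * (F xbar + inner l (g xbar) - F xstar) \<le> L1 * R\<^sup>2"
      using lagrangian_gap_bound[OF assms(26,25,10,11) f g xs that(1) lip[OF that(1)] Lip_le[OF that(2)]]
      by (simp add: xbar assms(12) R_def algebra_simps)
    then have "W N * (F xbar + inner l (g xbar) - F xstar) \<le> W N * (\<epsilon> / c)" using LR by simp
    then show ?thesis using WN by (simp only: mult_le_cancel_left_pos)
  qed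
  have "F xbar - F xstar \<le> \<epsilon> / c"
    using gap[of 0] by (simp add: multiplier_region_def)
  also have "\<dots> \<le> \<epsilon> / 1" using assms(2,3) by (intro divide_left_mono) auto
  finally have objective: "F xbar - F xstar \<le> \<epsilon>" by simp
  \<comment> \<open>The Lagrangian gap at \<open>lstar + v\<close> is the violation plus the gap at \<open>lstar\<close>, and the
    latter is nonnegative by the KKT conditions.\<close>
  obtain v where v: "0 \<le> v" "norm v \<le> 1" "inner v (g xbar) = norm (pos_part (g xbar))"
    by (rule norm_pos_part_certificate)
  have "0 \<le> lstar + v" using ls v(1) by (simp add: less_eq_vec_def)
  moreover have "lstar + v \<in> multiplier_region lstar 1"
    using v by (auto simp: multiplier_region_def)
  ultimately have "F xbar + inner (lstar + v) (g xbar) - F xstar \<le> \<epsilon> / c" by (rule gap)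
  moreover have "F xstar \<le> F xbar + inner lstar (g xbar)"
  proof -
    have "x t \<in> X" if "1 \<le> t" "t \<le> N" for t
      using assms(26) that by (auto simp: acgd_iterates_def acgd_step_def saddle_point_def)
    then have "xbar \<in> X" unfolding xbar by (rule avg_in_convex[OF assms(5) _ assms(25)])
    then show ?thesis
      using KKT_pair_lagrangian_minimal[OF assms(14) f g] lip[OF ls]
      by (simp add: assms(12) lipschitz_gradient_def)
  qed
  ultimately show ?thesis using objective v(3) by (simp add: inner_add_left)
qed

end
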